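(* Consider an extremal of the minimum-fuel low-thrust trajectory optimization problem described in the context, with planar dynamics, and suppose that the switching function satisfies $S=0$ on a nondegenerate interval $I_s\subset[t_0,t_f]$. Let $\beta$ be the angle from the position vector $\mathbf r$ to the optimal thrust direction $\mathbf n^*$, and let $e$ and $\theta$ be the eccentricity and true anomaly of the osculating orbit of the spacecraft. Then on $I_s$ the triple $(e,\theta,\beta)$ lies on the surface $$\Psi(e,\theta,\beta)=2\cos\beta\sin\beta\left(-1+\varepsilon_1\sqrt{\frac{1-3\cos^2\beta}{1+e\cos\theta}}-\varepsilon_2\sqrt{\frac{1-3\cos^2\beta}{1+e\cos\theta}}\right)-(1-3\cos^2\beta)\,\frac{e\sin\theta}{1+e\cos\theta}=0,$$ where the signs $\varepsilon_1,\varepsilon_2\in\{+1,-1\}$ are those defined in the context.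
   Context: **Problem.** A spacecraft with position $\mathbf r\neq \mathbf 0$, velocity $\mathbf v$ and mass $m>0$ obeys $$\dot{\mathbf r}=\mathbf v,\qquad \dot{\mathbf v}=-\mu\frac{\mathbf r}{\|\mathbf r\|^3}+\frac{T_{\max}}{m}\,c\,\mathbf n,\qquad \dot m=-\frac{T_{\max}}{I_{sp}g_0}\,c,$$ with controls $c\in[0,1]$ (throttle) and $\mathbf n$ (unit thrust direction), and positive constants $\mu,T_{\max},I_{sp},g_0$. One minimizes $J=-m(t_f)$ subject to these dynamics and fixed boundary conditions $\mathbf x(t_0)=\mathbf x_0$, $\mathbf x(t_f)=\mathbf x_f$, where $\mathbf x=(\mathbf r,\mathbf v,m)$. **Extremals (Pontryagin Maximum Principle).** There is a costate $(\mathbf p_r,\mathbf p_v,p_m)$, never equal to $\mathbf 0$ (nontriviality), such that $$\dot{\mathbf p}_r=-\frac{3\mu}{\|\mathbf r\|^5}(\mathbf r\cdot\mathbf p_v)\mathbf r+\frac{\mu}{\|\mathbf r\|^3}\mathbf p_v,\qquad \dot{\mathbf p}_v=-\mathbf p_r,\qquad \dot p_m=c\,\frac{\|\mathbf p_v\|T_{\max}}{m^2},$$ and the optimal controls maximize $\left[(\mathbf p_v\cdot\mathbf n)\frac{T_{\max}}{m}-p_m\frac{T_{\max}}{I_{sp}g_0}\right]c$. The optimal direction $\mathbf n^*$ maximizes $\mathbf p_v\cdot\mathbf n$ over unit vectors (so $\mathbf n^*=\mathbf p_v/\|\mathbf p_v\|$ whenever $\mathbf p_v\ne\mathbf 0$).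 The switching function is $$S=(\mathbf p_v\cdot\mathbf n^* )\frac{T_{\max}}{m}-p_m\frac{T_{\max}}{I_{sp}g_0}.$$ The optimal throttle is $c^*=1$ if $S>0$, $c^*=0$ if $S<0$, and $c^*\in(0,1)$ if $S=0$ (singular case). Identities involving the control or derivatives of the adjoint/state are understood almost everywhere. **Planar dynamics.** $\mathbf r,\mathbf v,\mathbf n,\mathbf p_r,\mathbf p_v$ all lie in a fixed plane with a fixed reference direction. Angles are oriented in the sense of the orbital motion, and the specific angular momentum $\mathbf h=\mathbf r\times\mathbf v$ is nonzero. $\alpha$ is the angle from the reference direction to $\mathbf r$, and $\beta$ is the angle from $\mathbf r$ to $\mathbf n^*$, so that on a singular arc $\delta=\alpha+\beta$ is the angle from the reference direction to $\mathbf p_v$. **Osculating elements.** $e\ge 0$ and $\theta$ are the eccentricity and true anomaly of the instantaneous Keplerian orbit with state $(\mathbf r,\mathbf v)$: $1+e\cos\theta=\|\mathbf h\|^2/(\mu\|\mathbf r\|)>0$ and $\mu e\sin\theta/\|\mathbf h\|=(\mathbf r\cdot\mathbf v)/\|\mathbf r\|$ (if $e=0$, $\theta$ is arbitrary). One has $\dot\alpha=\|\mathbf h\|/\|\mathbf r\|^2$. **Signs.** $\varepsilon_1$ is the sign of $\dot\alpha+\dot\beta$, i.e. $\dot\alpha+\dot\beta=\varepsilon_1|\dot\alpha+\dot\beta|$. On a singular arc $\mathbf p_r\perp\mathbf p_v$, and $\varepsilon_2$ is the sign such that the angle from $\mathbf r$ to $\mathbf p_r$ equals $\beta+\varepsilon_2\frac{\pi}{2}$.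 (If the corresponding quantity vanishes, either sign may be taken.) *)

theory Defs
  imports "HOL-Analysis.Analysis"
begin

unbundle cross3_syntax

text \<open>
  Absolute continuity on \<open>[a, b]\<close>; \<open>\<D>\<close> ranges over the finite families of non-overlapping compact
  subintervals \<open>K = [Inf K, Sup K]\<close> of \<open>[a, b]\<close>, which need not cover \<open>[a, b]\<close>.
\<close>

definition abs_cont_on_ivl :: "real \<Rightarrow> real \<Rightarrow> (real \<Rightarrow> 'a::real_normed_vector) \<Rightarrow> bool" where
  "abs_cont_on_ivl a b f \<longleftrightarrow>
     (\<forall>\<epsilon>>0. \<exists>\<delta>>0. \<forall>\<D>. \<D> division_of \<Union>\<D> \<longrightarrow> \<Union>\<D> \<subseteq> {a..b} \<longrightarrow>
        (\<Sum>K\<in>\<D>. Sup K - Inf K) < \<delta> \<longrightarrow> (\<Sum>K\<in>\<D>. norm (f (Sup K) - f (Inf K))) < \<epsilon>)"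

definition ae_solution ::
  "real \<Rightarrow> real \<Rightarrow> (real \<Rightarrow> 'a::real_normed_vector) \<Rightarrow> (real \<Rightarrow> 'a) \<Rightarrow> bool" where
  "ae_solution a b f f' \<longleftrightarrow>
     abs_cont_on_ivl a b f \<and>
     (AE t in lebesgue_on {a..b}. (f has_vector_derivative f' t) (at t within {a..b}))"

definition admissible ::
  "real \<Rightarrow> real \<Rightarrow> real \<Rightarrow> real \<Rightarrow> real \<Rightarrow> real \<Rightarrow>
   (real^3) \<times> (real^3) \<times> real \<Rightarrow> (real^3) \<times> (real^3) \<times> real \<Rightarrow>
   (real \<Rightarrow> real^3) \<Rightarrow> (real \<Rightarrow> real^3) \<Rightarrow> (real \<Rightarrow> real) \<Rightarrow>
   (real \<Rightarrow> real) \<Rightarrow> (real \<Rightarrow> real^3) \<Rightarrow> bool" where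
  "admissible \<mu> Tmax Isp g0 t0 tf x0 xf r v m c n \<longleftrightarrow>
     t0 < tf \<and>
     (\<forall>t\<in>{t0..tf}. r t \<noteq> 0 \<and> 0 < m t \<and> c t \<in> {0..1} \<and> norm (n t) = 1) \<and>
     (r t0, v t0, m t0) = x0 \<and> (r tf, v tf, m tf) = xf \<and>
     ae_solution t0 tf r v \<and>
     ae_solution t0 tf v
       (\<lambda>t. - (\<mu> / norm (r t) ^ 3) *\<^sub>R r t + (Tmax / m t * c t) *\<^sub>R n t) \<and>
     ae_solution t0 tf m (\<lambda>t. - (Tmax / (Isp * g0)) * c t)"

definition adjoint_solution ::
  "real \<Rightarrow> real \<Rightarrow> real \<Rightarrow> real \<Rightarrow>
   (real \<Rightarrow> real^3) \<Rightarrow> (real \<Rightarrow> real) \<Rightarrow> (real \<Rightarrow> real) \<Rightarrow>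
   (real \<Rightarrow> real^3) \<Rightarrow> (real \<Rightarrow> real^3) \<Rightarrow> (real \<Rightarrow> real) \<Rightarrow> bool" where
  "adjoint_solution \<mu> Tmax t0 tf r m c pr pv pm \<longleftrightarrow>
     (\<forall>t\<in>{t0..tf}. (pr t, pv t, pm t) \<noteq> 0) \<and>
     ae_solution t0 tf pr
       (\<lambda>t. - (3 * \<mu> / norm (r t) ^ 5 * (r t \<bullet> pv t)) *\<^sub>R r t + (\<mu> / norm (r t) ^ 3) *\<^sub>R pv t) \<and>
     ae_solution t0 tf pv (\<lambda>t. - pr t) \<and>
     ae_solution t0 tf pm (\<lambda>t. c t * (norm (pv t) * Tmax / (m t)\<^sup>2))"

text \<open>
  The factor of the throttle in the Hamiltonian for thrust direction \<open>n\<close>. For the optimal direction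
  it is the switching function.
\<close>

definition switching :: "real \<Rightarrow> real \<Rightarrow> real \<Rightarrow> real \<Rightarrow> real^3 \<Rightarrow> real \<Rightarrow> real^3 \<Rightarrow> real" where
  "switching Tmax Isp g0 m pv pm n = (pv \<bullet> n) * (Tmax / m) - pm * (Tmax / (Isp * g0))"

text \<open>
  Direction and throttle maximize the Hamiltonian, the direction being a maximizer of
  \<open>pv \<bullet> n\<close> also where the throttle vanishes.
\<close>

definition optimal_controls ::
  "real \<Rightarrow> real \<Rightarrow> real \<Rightarrow> real \<Rightarrow> real^3 \<Rightarrow> real \<Rightarrow> real \<Rightarrow> real^3 \<Rightarrow> bool" where
  "optimal_controls Tmax Isp g0 m pv pm c n \<longleftrightarrow>
     (\<forall>n' c'. norm n' = 1 \<longrightarrow> c' \<in> {0..1} \<longrightarrow>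
        switching Tmax Isp g0 m pv pm n' * c' \<le> switching Tmax Isp g0 m pv pm n * c) \<and>
     (\<forall>n'. norm n' = 1 \<longrightarrow> pv \<bullet> n' \<le> pv \<bullet> n) \<and>
     (0 < switching Tmax Isp g0 m pv pm n \<longrightarrow> c = 1) \<and>
     (switching Tmax Isp g0 m pv pm n < 0 \<longrightarrow> c = 0) \<and>
     (switching Tmax Isp g0 m pv pm n = 0 \<longrightarrow> c \<in> {0<..<1})"

definition extremal ::
  "real \<Rightarrow> real \<Rightarrow> real \<Rightarrow> real \<Rightarrow> real \<Rightarrow> real \<Rightarrow>
   (real^3) \<times> (real^3) \<times> real \<Rightarrow> (real^3) \<times> (real^3) \<times> real \<Rightarrow>
   (real \<Rightarrow> real^3) \<Rightarrow> (real \<Rightarrow> real^3) \<Rightarrow> (real \<Rightarrow> real) \<Rightarrow>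
   (real \<Rightarrow> real) \<Rightarrow> (real \<Rightarrow> real^3) \<Rightarrow>
   (real \<Rightarrow> real^3) \<Rightarrow> (real \<Rightarrow> real^3) \<Rightarrow> (real \<Rightarrow> real) \<Rightarrow> bool" where
  "extremal \<mu> Tmax Isp g0 t0 tf x0 xf r v m c n pr pv pm \<longleftrightarrow>
     admissible \<mu> Tmax Isp g0 t0 tf x0 xf r v m c n \<and>
     adjoint_solution \<mu> Tmax t0 tf r m c pr pv pm \<and>
     (AE t in lebesgue_on {t0..tf}.
        optimal_controls Tmax Isp g0 (m t) (pv t) (pm t) (c t) (n t))"

text \<open>
  The plane is the orthogonal complement of the unit vector \<open>k\<close>, and \<open>d\<close> is the reference
  direction. The unit normal \<open>k\<close> is the one on the side of the (nonzero) angular momentum, so that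
  counterclockwise angles about \<open>k\<close> are oriented in the sense of the orbital motion.
\<close>

definition planar_motion ::
  "real^3 \<Rightarrow> real^3 \<Rightarrow> real \<Rightarrow> real \<Rightarrow> (real \<Rightarrow> real^3) \<Rightarrow> (real \<Rightarrow> real^3) \<Rightarrow> (real \<Rightarrow> real^3) \<Rightarrow>
   (real \<Rightarrow> real^3) \<Rightarrow> (real \<Rightarrow> real^3) \<Rightarrow> bool" where
  "planar_motion k d t0 tf r v n pr pv \<longleftrightarrow>
     norm k = 1 \<and> norm d = 1 \<and> orthogonal k d \<and>
     (\<forall>t\<in>{t0..tf}. orthogonal k (r t) \<and> orthogonal k (v t) \<and> orthogonal k (n t) \<and>
        orthogonal k (pr t) \<and> orthogonal k (pv t) \<and> 0 < k \<bullet> (r t \<times> v t))"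

text \<open>
  For \<open>x \<noteq> 0\<close> in the plane, \<open>\<phi>\<close> is a determination of the oriented angle from \<open>x\<close> to \<open>y\<close>:
  \<open>y\<close> is \<open>norm y / norm x\<close> times the rotation of \<open>x\<close> by \<open>\<phi>\<close> about \<open>k\<close>.
  Every \<open>\<phi>\<close> qualifies if \<open>y = 0\<close>.
\<close>

definition oriented_angle :: "real^3 \<Rightarrow> real^3 \<Rightarrow> real^3 \<Rightarrow> real \<Rightarrow> bool" where
  "oriented_angle k x y \<phi> \<longleftrightarrow>
     norm x *\<^sub>R y = norm y *\<^sub>R (cos \<phi> *\<^sub>R x + sin \<phi> *\<^sub>R (k \<times> x))"

definition osculating :: "real \<Rightarrow> real^3 \<Rightarrow> real^3 \<Rightarrow> real \<Rightarrow> real \<Rightarrow> bool" where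
  "osculating \<mu> r v e \<theta> \<longleftrightarrow>
     0 \<le> e \<and>
     1 + e * cos \<theta> = (norm (r \<times> v))\<^sup>2 / (\<mu> * norm r) \<and>
     \<mu> * e * sin \<theta> / norm (r \<times> v) = (r \<bullet> v) / norm r"

definition Psi :: "real \<Rightarrow> real \<Rightarrow> real \<Rightarrow> real \<Rightarrow> real \<Rightarrow> real" where
  "Psi \<epsilon>1 \<epsilon>2 e \<theta> \<beta> =
     2 * cos \<beta> * sin \<beta> *
       (- 1 + \<epsilon>1 * sqrt ((1 - 3 * (cos \<beta>)\<^sup>2) / (1 + e * cos \<theta>))
            - \<epsilon>2 * sqrt ((1 - 3 * (cos \<beta>)\<^sup>2) / (1 + e * cos \<theta>)))
     - (1 - 3 * (cos \<beta>)\<^sup>2) * (e * sin \<theta> / (1 + e * cos \<theta>))"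

text \<open>
  Since \<open>sqrt\<close> is total, the condition that the square roots in the equation are
  those of nonnegative reals is part of the definition of the surface.
\<close>

definition singular_surface :: "real \<Rightarrow> real \<Rightarrow> (real \<times> real \<times> real) set" where
  "singular_surface \<epsilon>1 \<epsilon>2 =
     {(e, \<theta>, \<beta>). 1 + e * cos \<theta> \<noteq> 0 \<and> 0 \<le> (1 - 3 * (cos \<beta>)\<^sup>2) / (1 + e * cos \<theta>) \<and>
        Psi \<epsilon>1 \<epsilon>2 e \<theta> \<beta> = 0}"

end

theory Submission
  imports Defs
begin

text \<open>
  The identity \<open>S = 0\<close> and its a.e. derivative make \<open>\<parallel>pv\<parallel>\<close> a constant \<open>P\<close> and \<open>pv \<bullet> pr = 0\<close>; nontriviality
  forces \<open>P > 0\<close>. Differentiating \<open>pv \<bullet> pr = 0\<close> gives \<open>\<parallel>pr\<parallel>\<^sup>2 \<parallel>r\<parallel>\<^sup>3 = \<mu> P\<^sup>2 (1 - 3 cos\<^sup>2 \<beta>)\<close>, and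
  \<open>pv' = - pr\<close> gives \<open>\<alpha>' + \<beta>' = - \<epsilon>2 \<parallel>pr\<parallel> / P\<close>. Differentiating the former identity once more and
  inserting the latter, with \<open>\<alpha>' = h / \<parallel>r\<parallel>\<^sup>2\<close>, is the equation of the surface. Only \<open>r\<close>, \<open>pr\<close>, \<open>pv\<close>
  are differentiated at every time: their right-hand sides are continuous, so by the fundamental
  theorem of calculus for absolutely continuous functions they are continuously differentiable.
\<close>

subsection \<open>Absolutely continuous solutions\<close>

lemma AE_lebesgue_on_negligible:
  assumes "AE x in lebesgue_on S. P x" "S \<in> sets lebesgue"
  shows "\<exists>N. negligible N \<and> (\<forall>x\<in>S - N. P x)"
proof -
  from assms(1) obtain N where N: "N \<in> null_sets (lebesgue_on S)"
    "{x \<in> space (lebesgue_on S). \<not> P x} \<subseteq> N"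
    unfolding eventually_ae_filter by blast
  have "negligible N"
    using N(1) assms(2) by (simp add: null_sets_restrict_space negligible_iff_null_sets)
  moreover have "P x" if "x \<in> S - N" for x
    using N(2) that by (auto simp: space_restrict_space)
  ultimately show ?thesis by blast
qed

lemma abs_cont_on_ivl_subset:
  assumes "abs_cont_on_ivl a b f" "{c..d} \<subseteq> {a..b}"
  shows "abs_cont_on_ivl c d f"
  using assms unfolding abs_cont_on_ivl_def by (meson order_trans)

lemma abs_cont_on_ivl_imp_continuous_on:
  assumes "abs_cont_on_ivl a b f"
  shows "continuous_on {a..b} f"
  unfolding continuous_on_iff
proof (intro ballI allI impI)
  fix x \<epsilon> :: real
  assume x: "x \<in> {a..b}" and "0 < \<epsilon>"
  then obtain \<delta> where "0 < \<delta>" and \<delta>: "\<And>\<D>. \<D> division_of \<Union>\<D> \<Longrightarrow> \<Union>\<D> \<subseteq> {a..b} \<Longrightarrow>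
        (\<Sum>K\<in>\<D>. Sup K - Inf K) < \<delta> \<Longrightarrow> (\<Sum>K\<in>\<D>. norm (f (Sup K) - f (Inf K))) < \<epsilon>"
    using assms unfolding abs_cont_on_ivl_def by blast
  have *: "norm (f v - f u) < \<epsilon>" if "u \<in> {a..b}" "v \<in> {a..b}" "u \<le> v" "v - u < \<delta>" for u v
    using \<delta>[of "{{u..v}}"] that division_of_self[of u v] by simp
  then have "dist (f y) (f x) < \<epsilon>" if "y \<in> {a..b}" "dist y x < \<delta>" for y
    using *[OF that(1) x] *[OF x that(1)] that(2)
    by (cases x y rule: le_cases) (auto simp: dist_norm norm_minus_commute)
  then show "\<exists>d>0. \<forall>x'\<in>{a..b}. dist x' x < d \<longrightarrow> dist (f x') (f x) < \<epsilon>"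
    using \<open>0 < \<delta>\<close> by blast
qed

text \<open>
  Henstock's proof of the fundamental theorem, with the cells tagged in the exceptional set
  confined to a small open set, where absolute continuity bounds their contribution.
\<close>

lemma abs_cont_on_ivl_has_integral:
  fixes f :: "real \<Rightarrow> 'a::banach"
  assumes ac: "abs_cont_on_ivl a b f" and "a \<le> b" and "negligible N"
    and vecd: "\<And>x. x \<in> {a..b} - N \<Longrightarrow> (f has_vector_derivative f' x) (at x within {a..b})"
    and zero: "\<And>x. x \<in> N \<Longrightarrow> f' x = 0"
  shows "(f' has_integral (f b - f a)) {a..b}"
  unfolding has_integral box_real[symmetric]
proof safe
  fix \<epsilon> :: real
  assume "\<epsilon> > 0"
  \<comment> \<open>The summand \<open>1\<close> keeps the denominator positive when
    \<open>a = b\<close> and makes \<open>e * (b - a)\<close> strictly less than half of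
    \<epsilon>.\<close>
  define e where "e = \<epsilon> / (2 * (b - a + 1))"
  have "e > 0" and e: "e * (b - a) < \<epsilon> / 2"
    using \<open>\<epsilon> > 0\<close> \<open>a \<le> b\<close> by (auto simp: e_def field_simps)
  obtain \<delta> where "0 < \<delta>" and \<delta>: "\<And>\<D>. \<D> division_of \<Union>\<D> \<Longrightarrow> \<Union>\<D> \<subseteq> {a..b} \<Longrightarrow>
        (\<Sum>K\<in>\<D>. Sup K - Inf K) < \<delta> \<Longrightarrow> (\<Sum>K\<in>\<D>. norm (f (Sup K) - f (Inf K))) < \<epsilon> / 2"
    using ac \<open>\<epsilon> > 0\<close> unfolding abs_cont_on_ivl_def by (meson half_gt_zero)
  have "N \<in> null_sets lebesgue"
    using \<open>negligible N\<close> by (simp add: negligible_iff_null_sets)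
  then have "N \<in> sets lebesgue" by blast
  then obtain U where U: "open U" "N \<subseteq> U" "U - N \<in> lmeasurable" "emeasure lebesgue (U - N) < ennreal \<delta>"
    using sets_lebesgue_outer_open[of N \<delta>] \<open>0 < \<delta>\<close> by blast
  \<comment> \<open>Outer regularity bounds the measure of \<open>U - N\<close>; since
    \<open>N\<close> is null, the same bound holds for \<open>U\<close>.\<close>
  have Ueq: "U = (U - N) \<union> N" using U(2) by blast
  have lmU: "U \<in> lmeasurable"
    using U(3) Ueq \<open>negligible N\<close> by (metis fmeasurable.Un negligible_imp_measurable)
  have "emeasure lebesgue U < ennreal \<delta>"
    using U(4) \<open>N \<in> null_sets lebesgue\<close> \<open>open U\<close>
    by (metis emeasure_Diff_null_set lmU fmeasurableD)
  then have mU: "measure lebesgue U < \<delta>"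
    using lmU \<open>0 < \<delta>\<close> by (simp add: emeasure_eq_measure2 ennreal_less_iff)
  \<comment> \<open>Radii of the gauge: from differentiability on \<open>{a..b} - N\<close>, from
    the openness of \<open>U\<close> on \<open>N\<close>, and arbitrary elsewhere.\<close>
  have "\<forall>x. \<exists>d>0. (x \<in> {a..b} - N \<longrightarrow>
         (\<forall>y\<in>{a..b}. norm (y-x) < d \<longrightarrow> norm (f y - f x - (y-x) *\<^sub>R f' x) \<le> e * norm (y-x)))
         \<and> (x \<in> N \<longrightarrow> ball x d \<subseteq> U)"
  proof
    fix x
    show "\<exists>d>0. (x \<in> {a..b} - N \<longrightarrow>
         (\<forall>y\<in>{a..b}. norm (y-x) < d \<longrightarrow> norm (f y - f x - (y-x) *\<^sub>R f' x) \<le> e * norm (y-x)))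
         \<and> (x \<in> N \<longrightarrow> ball x d \<subseteq> U)"
    proof (cases "x \<in> N")
      case True
      then show ?thesis using U(1,2) open_contains_ball[of U] by blast
    next
      case False
      then show ?thesis
        using vecd[of x, unfolded has_vector_derivative_def has_derivative_within_alt] \<open>e > 0\<close>
        by (cases "x \<in> {a..b}") (auto intro: exI[of _ "1::real"])
    qed
  qed
  then obtain d where d: "\<And>x. 0 < d x"
      "\<And>x y. \<lbrakk>x \<in> {a..b} - N; y \<in> {a..b}; norm (y-x) < d x\<rbrakk>
                        \<Longrightarrow> norm (f y - f x - (y-x) *\<^sub>R f' x) \<le> e * norm (y-x)"
      "\<And>x. x \<in> N \<Longrightarrow> ball x (d x) \<subseteq> U"
    by metis
  show "\<exists>\<gamma>. gauge \<gamma> \<and> (\<forall>p. p tagged_division_of (cbox a b) \<and> \<gamma> fine p \<longrightarrow>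
    norm ((\<Sum>(x, k)\<in>p. measure lborel k *\<^sub>R f' x) - (f b - f a)) < \<epsilon>)"
  proof (rule exI, safe)
    show "gauge (\<lambda>x. ball x (d x))"
      using d(1) gauge_ball_dependent by blast
  next
    fix p
    assume ptag: "p tagged_division_of cbox a b" and finep: "(\<lambda>x. ball x (d x)) fine p"
    have ba: "b - a = (\<Sum>(x,K)\<in>p. Sup K - Inf K)" "f b - f a = (\<Sum>(x,K)\<in>p. f(Sup K) - f(Inf K))"
      using additive_tagged_division_1[where f= "\<lambda>x. x"] additive_tagged_division_1[where f= f]
            \<open>a \<le> b\<close> ptag by auto
    have "finite p" using ptag by blast
    have cell: "\<exists>u v. K = {u..v} \<and> u \<le> v \<and> x \<in> {u..v} \<and> {u..v} \<subseteq> {a..b} \<and> {u..v} \<subseteq> ball x (d x)"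
      if xK: "(x, K) \<in> p" for x K
    proof -
      obtain u v where K: "K = {u..v}"
        using tagged_division_ofD(4)[OF ptag xK] by auto
      have "x \<in> K" "K \<subseteq> {a..b}" "K \<subseteq> ball x (d x)"
        using tagged_division_ofD(2,3)[OF ptag xK] fineD[OF finep xK] by auto
      then have "K = {u..v} \<and> u \<le> v \<and> x \<in> {u..v} \<and> {u..v} \<subseteq> {a..b} \<and> {u..v} \<subseteq> ball x (d x)"
        using K by auto
      then show ?thesis by blast
    qed
    define q where "q = {(x, K) \<in> p. x \<in> N}"
    have "q \<subseteq> p" by (auto simp: q_def)
    \<comment> \<open>Straddle estimate: the tag lies between the endpoints, so the two errors add
      up to \<open>e\<close> times the length of the cell.\<close>
    have regular: "norm ((measure lborel K *\<^sub>R f' x) - (f (Sup K) - f (Inf K))) \<le> e * (Sup K - Inf K)"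
      if xK: "(x, K) \<in> p" and "x \<notin> N" for x K
    proof -
      obtain u v where K: "K = {u..v}" "u \<le> v" "x \<in> {u..v}" "{u..v} \<subseteq> {a..b}" "{u..v} \<subseteq> ball x (d x)"
        using cell[OF xK] by blast
      have *: "u \<in> {u..v}" "v \<in> {u..v}" using K(2) by auto
      have "norm ((v - u) *\<^sub>R f' x - (f v - f u)) = norm (f u - f x - (u - x) *\<^sub>R f' x - (f v - f x - (v - x) *\<^sub>R f' x))"
        by (auto simp: algebra_simps)
      also have "\<dots> \<le> norm (f u - f x - (u - x) *\<^sub>R f' x) + norm (f v - f x - (v - x) *\<^sub>R f' x)"
        by (rule norm_triangle_ineq4)
      also have "\<dots> \<le> e * norm (u - x) + e * norm (v - x)"
      proof (intro add_mono d(2))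
        show "norm (u - x) < d x" "norm (v - x) < d x"
          using K(5) * by (auto simp: subset_iff mem_ball dist_norm norm_minus_commute)
      qed (use K * \<open>x \<notin> N\<close> in auto)
      also have "\<dots> = e * (v - u)"
        using K(3) by (simp add: algebra_simps)
      finally show ?thesis using K by simp
    qed
    have "norm (\<Sum>(x, K) \<in> p - q. (measure lborel K *\<^sub>R f' x) - (f (Sup K) - f (Inf K)))
          \<le> (\<Sum>(x, K) \<in> p - q. e * (Sup K - Inf K))"
      by (rule sum_norm_le) (auto simp: q_def intro: regular)
    also have "\<dots> \<le> (\<Sum>(x, K) \<in> p. e * (Sup K - Inf K))"
      using \<open>finite p\<close> \<open>e > 0\<close> by (intro sum_mono2) (auto dest!: cell)
    also have "\<dots> = e * (b - a)"
      by (simp add: ba(1) sum_distrib_left split_def)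
    finally have good: "norm (\<Sum>(x, K) \<in> p - q. (measure lborel K *\<^sub>R f' x) - (f (Sup K) - f (Inf K)))
          \<le> e * (b - a)" .
    have "q tagged_partial_division_of cbox a b"
      using tagged_partial_division_subset[of p "cbox a b" q] ptag \<open>q \<subseteq> p\<close>
      by (simp add: tagged_division_of_def)
    then have qtag: "q tagged_division_of \<Union>(snd ` q)"
      by (rule tagged_partial_division_of_Union_self)
    then have qdiv: "snd ` q division_of \<Union>(snd ` q)"
      by (rule division_of_tagged_division)
    have qU: "\<Union>(snd ` q) \<subseteq> U"
    proof
      fix y assume "y \<in> \<Union>(snd ` q)"
      then obtain x K where "(x, K) \<in> p" "x \<in> N" "y \<in> K" by (auto simp: q_def)
      then show "y \<in> U" using cell[of x K] d(3)[of x] by blast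
    qed
    \<comment> \<open>The cells do not overlap, so their total length is the measure of their union,
      which lies inside \<open>U\<close>.\<close>
    have "(\<Sum>K\<in>snd ` q. Sup K - Inf K) = (\<Sum>K\<in>snd ` q. measure lebesgue K)"
      using \<open>q \<subseteq> p\<close> by (intro sum.cong) (auto dest!: cell)
    also have "\<dots> = measure lebesgue (\<Union>(snd ` q))"
      using content_division[OF qdiv] qdiv by simp
    also have "\<dots> \<le> measure lebesgue U"
      using qU lmU lmeasurable_division[OF qdiv] by (intro measure_mono_fmeasurable) auto
    finally have "(\<Sum>K\<in>snd ` q. Sup K - Inf K) < \<delta>" using mU by simp
    moreover have "\<Union>(snd ` q) \<subseteq> {a..b}"
    proof
      fix y assume "y \<in> \<Union>(snd ` q)"
      then obtain x K where "(x, K) \<in> p" "y \<in> K" by (auto simp: q_def)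
      then show "y \<in> {a..b}" using cell[of x K] by blast
    qed
    ultimately have "(\<Sum>K\<in>snd ` q. norm (f (Sup K) - f (Inf K))) < \<epsilon> / 2"
      by (intro \<delta> qdiv)
    \<comment> \<open>Passing from cells to tagged cells requires a summand that vanishes on cells
      with empty interior, and \<open>f (Sup K) - f (Inf K)\<close> need not vanish for
      \<open>K = {}\<close>. Hence the case distinction, removed again because tagged cells are
      nonempty.\<close>
    also have "(\<Sum>K\<in>snd ` q. norm (f (Sup K) - f (Inf K)))
        = (\<Sum>K\<in>snd ` q. if K = {} then 0 else norm (f (Sup K) - f (Inf K)))"
      using qdiv by (intro sum.cong) auto
    also have "\<dots> = (\<Sum>(x,K)\<in>q. if K = {} then 0 else norm (f (Sup K) - f (Inf K)))"
    proof (rule sum.over_tagged_division_lemma[OF qtag, symmetric])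
      fix u v :: real
      assume "box u v = {}"
      then show "(if cbox u v = {} then 0 else norm (f (Sup (cbox u v)) - f (Inf (cbox u v)))) = 0"
        by (cases "u = v") auto
    qed
    also have "\<dots> = (\<Sum>(x,K)\<in>q. norm (f (Sup K) - f (Inf K)))"
    proof (intro sum.cong refl)
      fix xK assume "xK \<in> q"
      then have "snd xK \<noteq> {}"
        using tagged_division_ofD(2)[OF qtag, of "fst xK" "snd xK"] by auto
      then show "(case xK of (x, K) \<Rightarrow> if K = {} then 0 else norm (f (Sup K) - f (Inf K)))
          = (case xK of (x, K) \<Rightarrow> norm (f (Sup K) - f (Inf K)))"
        by (simp add: split_def)
    qed
    finally have "(\<Sum>(x,K)\<in>q. norm (f (Sup K) - f (Inf K))) < \<epsilon> / 2" .
    then have small: "norm (\<Sum>(x,K)\<in>q. f (Sup K) - f (Inf K)) < \<epsilon> / 2"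
      using norm_sum[of "\<lambda>(x,K). f (Sup K) - f (Inf K)" q] by (simp add: split_def)
    have "(\<Sum>(x, K)\<in>p. measure lborel K *\<^sub>R f' x) - (f b - f a)
        = (\<Sum>(x,K)\<in>p. (measure lborel K *\<^sub>R f' x) - (f (Sup K) - f (Inf K)))"
      by (simp add: ba(2) split_def sum_subtractf)
    also have "\<dots> = (\<Sum>(x, K) \<in> p - q. (measure lborel K *\<^sub>R f' x) - (f (Sup K) - f (Inf K)))
        + (\<Sum>(x, K) \<in> q. (measure lborel K *\<^sub>R f' x) - (f (Sup K) - f (Inf K)))"
      by (rule sum.subset_diff[OF \<open>q \<subseteq> p\<close> \<open>finite p\<close>])
    \<comment> \<open>\<open>f'\<close> vanishes at tags in \<open>N\<close>, so these cells
      contribute only increments of \<open>f\<close>.\<close>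
    also have "(\<Sum>(x,K)\<in>q. (measure lborel K *\<^sub>R f' x) - (f (Sup K) - f (Inf K)))
        = - (\<Sum>(x,K)\<in>q. f (Sup K) - f (Inf K))"
      unfolding sum_negf[symmetric] by (intro sum.cong) (auto simp: q_def zero)
    finally show "norm ((\<Sum>(x, K)\<in>p. measure lborel K *\<^sub>R f' x) - (f b - f a)) < \<epsilon>"
      using good e small norm_triangle_ineq4[of "\<Sum>(x, K) \<in> p - q. (measure lborel K *\<^sub>R f' x) - (f (Sup K) - f (Inf K))"
          "\<Sum>(x,K)\<in>q. f (Sup K) - f (Inf K)"] by simp
  qed
qed

lemma ae_solution_has_integral:
  fixes f :: "real \<Rightarrow> 'a::banach"
  assumes "ae_solution a b f f'" "a \<le> c" "c \<le> b"
  shows "(f' has_integral (f c - f a)) {a..c}"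
proof -
  obtain N where N: "negligible N" "\<And>x. x \<in> {a..b} - N \<Longrightarrow> (f has_vector_derivative f' x) (at x within {a..b})"
    using AE_lebesgue_on_negligible[OF conjunct2[OF assms(1)[unfolded ae_solution_def]]] by fastforce
  have sub: "{a..c} \<subseteq> {a..b}" using assms(3) by auto
  \<comment> \<open>Nothing is known of \<open>f'\<close> on \<open>N\<close>; it is reset to
    \<open>0\<close> there, which leaves the integral unchanged.\<close>
  have "((\<lambda>x. if x \<in> N then 0 else f' x) has_integral (f c - f a)) {a..c}"
  proof (rule abs_cont_on_ivl_has_integral)
    show "abs_cont_on_ivl a c f"
      using assms(1) sub abs_cont_on_ivl_subset unfolding ae_solution_def by blast
    show "(f has_vector_derivative (if x \<in> N then 0 else f' x)) (at x within {a..c})" if "x \<in> {a..c} - N" for x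
      using N(2)[of x] that sub by (auto intro: has_vector_derivative_within_subset)
  qed (use N(1) assms(2) in auto)
  then show ?thesis
    by (rule has_integral_spike[OF N(1), rotated]) auto
qed

text \<open>Continuity of \<open>f'\<close> promotes the almost everywhere equation:
  \<open>f\<close> is its initial value plus the integral of \<open>f'\<close>, and this integral is
  differentiable at every point of the interval, one-sidedly at its ends.\<close>

lemma ae_solution_has_vector_derivative:
  fixes f :: "real \<Rightarrow> 'a::banach"
  assumes sol: "ae_solution a b f f'" and cont: "continuous_on {a..b} f'" and x: "x \<in> {a..b}"
  shows "(f has_vector_derivative f' x) (at x within {a..b})"
proof -
  have "((\<lambda>u. f a + integral {a..u} f') has_vector_derivative 0 + f' x) (at x within {a..b})"
    by (intro has_vector_derivative_add has_vector_derivative_const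
        integral_has_vector_derivative[OF cont x])
  moreover have "f a + integral {a..u} f' = f u" if "u \<in> {a..b}" for u
    using integral_unique[OF ae_solution_has_integral[OF sol]] that by simp
  ultimately show ?thesis
    using has_vector_derivative_transform[OF x, of f "\<lambda>u. f a + integral {a..u} f'"] by simp
qed

section \<open>Continuous functions that agree almost everywhere on an interval\<close>

lemma ivl_has_nondegenerate_nbhd:
  fixes S :: "real set"
  assumes "is_interval S" "\<exists>a\<in>S. \<exists>b\<in>S. a < b" "x \<in> S" "0 < \<delta>"
  obtains u v where "u < v" "{u<..<v} \<subseteq> S \<inter> ball x \<delta>"
proof -
  \<comment> \<open>\<open>x\<close> may be an endpoint of \<open>S\<close>, so the open interval is
    taken on the side of \<open>x\<close> where another point \<open>y\<close> of \<open>S\<close>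
    lies.\<close>
  obtain y where y: "y \<in> S" "y \<noteq> x" using assms(2) by (metis less_irrefl)
  have S: "\<And>p q t. p \<in> S \<Longrightarrow> q \<in> S \<Longrightarrow> p \<le> t \<Longrightarrow> t \<le> q \<Longrightarrow> t \<in> S"
    using assms(1) unfolding is_interval_1 by blast
  show thesis
  proof (cases "x < y")
    case True
    show thesis
      by (rule that[of x "min y (x + \<delta>)"])
        (use True assms(4) S[OF assms(3) y(1)] in \<open>auto simp: dist_real_def\<close>)
  next
    case False
    show thesis
      by (rule that[of "max y (x - \<delta>)" x])
        (use False y assms(4) S[OF y(1) assms(3)] in \<open>auto simp: dist_real_def\<close>)
  qed
qed

text \<open>By continuity, a difference at \<open>x\<close> would persist on a nondegenerate open
  interval inside \<open>S\<close>, which is not negligible. This extends almost everywhere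
  identities to every point of the singular arc.\<close>

lemma eq_on_ivl_if_eq_outside_negligible:
  fixes f g :: "real \<Rightarrow> 'a::metric_space"
  assumes S: "is_interval S" "\<exists>a\<in>S. \<exists>b\<in>S. a < b"
    and f: "continuous_on S f" and g: "continuous_on S g"
    and N: "negligible N" "\<And>t. t \<in> S - N \<Longrightarrow> f t = g t" and x: "x \<in> S"
  shows "f x = g x"
proof (rule ccontr)
  assume "f x \<noteq> g x"
  have "continuous_on S (\<lambda>t. dist (f t) (g t))"
    by (intro continuous_intros f g)
  then obtain \<delta> where "0 < \<delta>" and \<delta>: "\<And>t. t \<in> S \<Longrightarrow> dist t x < \<delta> \<Longrightarrow>
      dist (dist (f t) (g t)) (dist (f x) (g x)) < dist (f x) (g x)"
    using x \<open>f x \<noteq> g x\<close> unfolding continuous_on_iff by (metis zero_less_dist_iff)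
  then have ne: "f t \<noteq> g t" if "t \<in> S" "dist t x < \<delta>" for t
    using that by (fastforce simp: dist_real_def)
  obtain u v where uv: "u < v" "{u<..<v} \<subseteq> S \<inter> ball x \<delta>"
    using ivl_has_nondegenerate_nbhd[OF S x \<open>0 < \<delta>\<close>] .
  have "{u<..<v} \<subseteq> N"
    using uv(2) N(2) ne by (fastforce simp: dist_commute)
  then have "negligible {u<..<v}"
    using N(1) negligible_subset by blast
  then show False
    using uv(1) open_not_negligible[of "{u<..<v}"] by auto
qed

subsection \<open>Oriented angles in a plane\<close>

text \<open>On the plane orthogonal to \<open>k\<close>, taking the cross product with
  \<open>k\<close> is a quarter turn, so doing it twice is a half turn.\<close>

lemma cross_unit_cross:
  assumes "norm k = 1" "orthogonal k x"
  shows "k \<times> (k \<times> x) = - x"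
  using assms by (simp add: Lagrange orthogonal_def dot_square_norm)

lemma cross_eq_scaled_normal:
  assumes "norm k = 1" "orthogonal k x" "orthogonal k y"
  shows "x \<times> y = (k \<bullet> (x \<times> y)) *\<^sub>R k"
proof -
  have "k \<times> (x \<times> y) = 0"
    using assms by (simp add: Lagrange orthogonal_def)
  then have "k \<times> (k \<times> (x \<times> y)) = 0" by simp
  then show ?thesis
    using assms(1) Lagrange[of k k "x \<times> y"] by (simp add: dot_square_norm)
qed

lemma triple_product_cyclic: "k \<bullet> (x \<times> y) = (k \<times> x) \<bullet> y"
  by (metis cross_triple inner_commute)

text \<open>\<open>x\<close> and \<open>k \<times> x\<close> are orthogonal and of equal length,
  hence a basis of the plane for nonzero \<open>x\<close>. The factor \<open>x \<bullet> x\<close>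
  clears the denominators and covers \<open>x = 0\<close>.\<close>

lemma planar_decomposition:
  assumes "norm k = 1" "orthogonal k x" "orthogonal k y"
  shows "(x \<bullet> x) *\<^sub>R y = (x \<bullet> y) *\<^sub>R x + ((k \<times> x) \<bullet> y) *\<^sub>R (k \<times> x)"
proof -
  have "x \<times> (x \<times> y) = - (((k \<times> x) \<bullet> y) *\<^sub>R (k \<times> x))"
    by (subst cross_eq_scaled_normal[OF assms])
      (simp add: cross_mult_right triple_product_cyclic cross_skew[of x k])
  then show ?thesis
    by (simp add: Lagrange algebra_simps)
qed

lemma oriented_angle_inner:
  assumes "oriented_angle k x y \<phi>"
  shows "x \<bullet> y = norm x * norm y * cos \<phi>"
proof (cases "x = 0")
  case False
  have "norm x * (x \<bullet> y) = x \<bullet> (norm y *\<^sub>R (cos \<phi> *\<^sub>R x + sin \<phi> *\<^sub>R (k \<times> x)))"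
    using assms unfolding oriented_angle_def by (metis inner_scaleR_right)
  also have "\<dots> = norm x * (norm x * norm y * cos \<phi>)"
    by (simp add: inner_add_right dot_cross_self dot_square_norm power2_eq_square)
  finally show ?thesis using False by simp
qed simp

lemma oriented_angle_cross_inner:
  assumes "norm k = 1" "orthogonal k x" "oriented_angle k x y \<phi>"
  shows "(k \<times> x) \<bullet> y = norm x * norm y * sin \<phi>"
proof (cases "x = 0")
  case False
  have "norm x * ((k \<times> x) \<bullet> y) = (k \<times> x) \<bullet> (norm y *\<^sub>R (cos \<phi> *\<^sub>R x + sin \<phi> *\<^sub>R (k \<times> x)))"
    using assms(3) unfolding oriented_angle_def by (metis inner_scaleR_right)
  also have "\<dots> = norm x * (norm x * norm y * sin \<phi>)"
    using norm_cross[of k x] assms(1,2)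
    by (simp add: inner_add_right dot_cross_self dot_square_norm orthogonal_def power2_eq_square)
  finally show ?thesis using False by simp
qed simp

text \<open>Signed area spanned by \<open>y\<close> and \<open>z\<close>: expanding \<open>y\<close>
  in the basis \<open>x\<close>, \<open>k \<times> x\<close> reduces it to the subtraction formula
  for the sine. It serves for the angle swept by a moving vector and for the angle from
  \<open>pv\<close> to \<open>pr\<close>.\<close>

lemma oriented_angle_cross_inner_diff:
  assumes k: "norm k = 1" "orthogonal k x" "orthogonal k y" "orthogonal k z" and "x \<noteq> 0"
    and y: "oriented_angle k x y \<phi>" and z: "oriented_angle k x z \<psi>"
  shows "(k \<times> y) \<bullet> z = norm y * norm z * sin (\<psi> - \<phi>)"
proof -
  have "(x \<bullet> x) *\<^sub>R (k \<times> y) = k \<times> ((x \<bullet> y) *\<^sub>R x + ((k \<times> x) \<bullet> y) *\<^sub>R (k \<times> x))"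
    using planar_decomposition[OF k(1-3)] by (simp add: cross_mult_right[symmetric])
  also have "\<dots> = (x \<bullet> y) *\<^sub>R (k \<times> x) - ((k \<times> x) \<bullet> y) *\<^sub>R x"
    by (simp add: cross_add_right cross_mult_right cross_unit_cross[OF k(1,2)])
  finally have "(x \<bullet> x) * ((k \<times> y) \<bullet> z) = (x \<bullet> y) * ((k \<times> x) \<bullet> z) - ((k \<times> x) \<bullet> y) * (x \<bullet> z)"
    by (metis inner_diff_left inner_scaleR_left)
  also have "\<dots> = (x \<bullet> x) * (norm y * norm z * sin (\<psi> - \<phi>))"
    by (simp add: oriented_angle_inner[OF y] oriented_angle_inner[OF z] dot_square_norm sin_diff
        oriented_angle_cross_inner[OF k(1,2) y] oriented_angle_cross_inner[OF k(1,2) z]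
        power2_eq_square algebra_simps)
  finally show ?thesis using \<open>x \<noteq> 0\<close> by simp
qed

text \<open>Rotations about \<open>k\<close> compose by adding angles. The condition
  \<open>y \<noteq> 0\<close> makes the intermediate angle meaningful, since every angle fits the
  zero vector.\<close>

lemma oriented_angle_add:
  assumes k: "norm k = 1" "orthogonal k x" and "y \<noteq> 0"
    and y: "oriented_angle k x y \<phi>" and z: "oriented_angle k y z \<psi>"
  shows "oriented_angle k x z (\<phi> + \<psi>)"
proof -
  let ?c = "cos \<psi>" and ?s = "sin \<psi>"
  have "norm y *\<^sub>R (norm x *\<^sub>R z) = norm x *\<^sub>R (norm z *\<^sub>R (?c *\<^sub>R y + ?s *\<^sub>R (k \<times> y)))"
    using arg_cong[OF z[unfolded oriented_angle_def], of "\<lambda>u. norm x *\<^sub>R u"]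
    by (simp add: mult.commute)
  also have "\<dots> = norm z *\<^sub>R (?c *\<^sub>R (norm x *\<^sub>R y) + ?s *\<^sub>R (k \<times> (norm x *\<^sub>R y)))"
    by (simp add: cross_mult_right algebra_simps)
  also have "norm x *\<^sub>R y = norm y *\<^sub>R (cos \<phi> *\<^sub>R x + sin \<phi> *\<^sub>R (k \<times> x))"
    using y by (simp add: oriented_angle_def)
  also have "norm z *\<^sub>R (?c *\<^sub>R (norm y *\<^sub>R (cos \<phi> *\<^sub>R x + sin \<phi> *\<^sub>R (k \<times> x)))
        + ?s *\<^sub>R (k \<times> (norm y *\<^sub>R (cos \<phi> *\<^sub>R x + sin \<phi> *\<^sub>R (k \<times> x)))))
      = norm y *\<^sub>R (norm z *\<^sub>R (cos (\<phi> + \<psi>) *\<^sub>R x + sin (\<phi> + \<psi>) *\<^sub>R (k \<times> x)))"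
    by (simp add: cross_mult_right cross_add_right cross_unit_cross[OF k] cos_add sin_add algebra_simps)
  finally show ?thesis
    using \<open>y \<noteq> 0\<close> unfolding oriented_angle_def scaleR_cancel_left by simp
qed

text \<open>This is the angular velocity of a planar vector. Only continuity of \<phi> is assumed:
  near \<open>x\<close> it coincides with \<open>\<phi> x\<close> plus the arcsine of
  \<open>g\<close>, the sine of the angle from \<open>f x\<close> to \<open>f t\<close>, and so
  inherits differentiability at \<open>x\<close>.\<close>

lemma oriented_angle_has_vector_derivative:
  assumes k: "norm k = 1" "orthogonal k d" and "d \<noteq> 0" and "x \<in> S"
    and plane: "\<And>t. t \<in> S \<Longrightarrow> orthogonal k (f t)"
    and cont: "continuous_on S \<phi>"
    and angle: "\<And>t. t \<in> S \<Longrightarrow> oriented_angle k d (f t) (\<phi> t)"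
    and f: "(f has_vector_derivative f') (at x within S)" and "f x \<noteq> 0"
  shows "(\<phi> has_vector_derivative ((k \<times> f x) \<bullet> f') / (norm (f x))\<^sup>2) (at x within S)"
proof -
  define g where "g t = ((k \<times> f x) \<bullet> f t) / (norm (f x) * norm (f t))" for t
  have "(\<lambda>h. (k \<times> f x) \<bullet> (h *\<^sub>R f')) = (*) ((k \<times> f x) \<bullet> f')"
    by (simp add: fun_eq_iff)
  then have N: "((\<lambda>t. (k \<times> f x) \<bullet> f t) has_field_derivative (k \<times> f x) \<bullet> f') (at x within S)"
    using has_derivative_inner_right[OF f[unfolded has_vector_derivative_def], of "k \<times> f x"]
    unfolding has_field_derivative_def by simp
  \<comment> \<open>The value \<open>D'\<close> drops out of the quotient rule, because the
    numerator of \<open>g\<close> vanishes at \<open>x\<close>.\<close>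
  obtain D' where D: "((\<lambda>t. norm (f x) * norm (f t)) has_field_derivative D') (at x within S)"
  proof -
    have "((\<lambda>t. norm (f t)) has_derivative (\<lambda>h. sgn (f x) \<bullet> (h *\<^sub>R f'))) (at x within S)"
      using has_derivative_compose[OF f[unfolded has_vector_derivative_def] has_derivative_norm] \<open>f x \<noteq> 0\<close>
      by (simp add: inner_commute)
    moreover have "(\<lambda>h. sgn (f x) \<bullet> (h *\<^sub>R f')) = (*) (sgn (f x) \<bullet> f')"
      by (simp add: fun_eq_iff)
    ultimately have "((\<lambda>t. norm (f t)) has_field_derivative (sgn (f x) \<bullet> f')) (at x within S)"
      unfolding has_field_derivative_def by simp
    from DERIV_cmult[OF this] that show thesis by blast
  qed
  have gx: "g x = 0" by (simp add: g_def dot_cross_self)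
  have "(g has_field_derivative ((k \<times> f x) \<bullet> f') / (norm (f x))\<^sup>2) (at x within S)"
    unfolding g_def
    using DERIV_divide[OF N D] \<open>f x \<noteq> 0\<close> by (simp add: dot_cross_self power2_eq_square field_simps)
  moreover have "(arcsin has_field_derivative 1) (at (g x))"
    using DERIV_arcsin[of "g x"] by (simp add: gx)
  ultimately have "((\<lambda>t. arcsin (g t)) has_field_derivative 1 * (((k \<times> f x) \<bullet> f') / (norm (f x))\<^sup>2)) (at x within S)"
    by (rule DERIV_chain2[rotated])
  from DERIV_add[OF DERIV_const this, of "\<phi> x"]
  have main: "((\<lambda>t. \<phi> x + arcsin (g t)) has_field_derivative ((k \<times> f x) \<bullet> f') / (norm (f x))\<^sup>2) (at x within S)"
    by simp
  \<comment> \<open>Close to \<open>x\<close> the angle changes by less than a right angle, where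
    the arcsine inverts the sine; the second radius keeps \<open>f t\<close> away from zero.\<close>
  have "\<exists>\<delta>>0. \<forall>t\<in>S. dist t x < \<delta> \<longrightarrow> dist (\<phi> t) (\<phi> x) < pi / 2"
    using cont \<open>x \<in> S\<close> pi_half_gt_zero unfolding continuous_on_iff by blast
  then obtain \<delta>1 where \<delta>1: "0 < \<delta>1" "\<And>t. t \<in> S \<Longrightarrow> dist t x < \<delta>1 \<Longrightarrow> dist (\<phi> t) (\<phi> x) < pi / 2"
    by blast
  have "continuous (at x within S) f"
    using f has_vector_derivative_continuous by blast
  then obtain \<delta>2 where \<delta>2: "0 < \<delta>2" "\<And>t. t \<in> S \<Longrightarrow> dist t x < \<delta>2 \<Longrightarrow> dist (f t) (f x) < norm (f x)"
    using \<open>f x \<noteq> 0\<close> unfolding continuous_within_eps_delta by (metis zero_less_norm_iff)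
  have "\<phi> x + arcsin (g t) = \<phi> t" if t: "t \<in> S" "dist t x < min \<delta>1 \<delta>2" for t
  proof -
    have "f t \<noteq> 0" using \<delta>2(2)[of t] t by auto
    have "(k \<times> f x) \<bullet> f t = norm (f x) * norm (f t) * sin (\<phi> t - \<phi> x)"
      by (rule oriented_angle_cross_inner_diff[of k d])
        (use k plane angle t(1) \<open>x \<in> S\<close> \<open>d \<noteq> 0\<close> in auto)
    then have "g t = sin (\<phi> t - \<phi> x)"
      using \<open>f t \<noteq> 0\<close> \<open>f x \<noteq> 0\<close> by (simp add: g_def)
    moreover have "\<bar>\<phi> t - \<phi> x\<bar> < pi / 2"
      using \<delta>1(2)[of t] t by (simp add: dist_real_def)
    then have "arcsin (sin (\<phi> t - \<phi> x)) = \<phi> t - \<phi> x"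
      by (intro arcsin_sin) linarith+
    ultimately show ?thesis by simp
  qed
  then show ?thesis
    using has_field_derivative_transform_within[OF main, of "min \<delta>1 \<delta>2" \<phi>] \<delta>1(1) \<delta>2(1) \<open>x \<in> S\<close>
    by (simp add: has_real_derivative_iff_has_vector_derivative)
qed

subsection \<open>Singular arcs\<close>

text \<open>The algebra at a single time: \<open>R\<close>, \<open>P\<close>, \<open>q\<close>,
  \<open>h\<close> stand for the norms of \<open>r\<close>, \<open>pv\<close>, \<open>pr\<close>,
  \<open>r \<times> v\<close>, and \<open>s\<close> for \<open>r \<bullet> v\<close>. The assumption
  \<open>balance\<close> is the differentiated form of the assumption \<open>q\<close>.\<close>

lemma singular_surface_if_balance:
  fixes \<mu> R P q h s :: real
  assumes pos: "0 < \<mu>" "0 < R" "0 < P" "0 \<le> q" "0 < h"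
    and signs: "\<epsilon>1 \<in> {1, -1}" "\<epsilon>2 \<in> {1, -1}"
    and q: "q\<^sup>2 * R ^ 3 = \<mu> * P\<^sup>2 * (1 - 3 * (cos \<beta>)\<^sup>2)"
    and balance: "6 * \<mu> * P * q * \<epsilon>2 * cos \<beta> * sin \<beta> + 3 * R * s * q\<^sup>2
      = 6 * \<mu> * P\<^sup>2 * cos \<beta> * sin \<beta> * \<beta>'"
    and \<omega>: "h / R\<^sup>2 + \<beta>' = - \<epsilon>2 * q / P" "h / R\<^sup>2 + \<beta>' = \<epsilon>1 * \<bar>h / R\<^sup>2 + \<beta>'\<bar>"
    and osc: "1 + e * cos \<theta> = h\<^sup>2 / (\<mu> * R)" "\<mu> * e * sin \<theta> / h = s / R"
  shows "(e, \<theta>, \<beta>) \<in> singular_surface \<epsilon>1 \<epsilon>2"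
proof -
  define C where "C = cos \<beta>"
  define B where "B = sin \<beta>"
  define Q where "Q = 1 - 3 * C\<^sup>2"
  have q': "q\<^sup>2 * R ^ 3 = \<mu> * P\<^sup>2 * Q" using q by (simp add: Q_def C_def)
  \<comment> \<open>The osculating relation turns the radicand into a perfect square, which yields
    its nonnegativity as well as its root.\<close>
  have ratio: "Q / (1 + e * cos \<theta>) = (q * R\<^sup>2 / (P * h))\<^sup>2"
  proof -
    have "Q = q\<^sup>2 * R ^ 3 / (\<mu> * P\<^sup>2)" using q' pos by (simp add: field_simps)
    then show ?thesis unfolding osc(1) using pos
      by (simp add: field_simps power2_eq_square power3_eq_cube)
  qed
  then have root: "sqrt (Q / (1 + e * cos \<theta>)) = q * R\<^sup>2 / (P * h)"
    using pos by simp
  have "e * sin \<theta> = s * h / (R * \<mu>)"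
    using osc(2) pos by (simp add: field_simps)
  then have tang: "e * sin \<theta> / (1 + e * cos \<theta>) = s / h"
    unfolding osc(1) using pos by (simp add: field_simps power2_eq_square)
  \<comment> \<open>The two assumptions on the angular rate of \<open>pv\<close> give its size
    \<open>q / P\<close> and then its sign as \<epsilon>1. Thus \<epsilon>1 enters the surface
    through \<open>\<beta>'\<close>, while \<epsilon>2 stays in \<open>balance\<close>.\<close>
  have "\<bar>h / R\<^sup>2 + \<beta>'\<bar> = q / P"
    using signs(2) pos unfolding \<omega>(1) by auto
  then have \<beta>': "\<beta>' = \<epsilon>1 * q / P - h / R\<^sup>2"
    using \<omega>(2) by simp
  have "3 * R * s * q\<^sup>2 = 3 * \<mu> * P\<^sup>2 * (Q * s / R\<^sup>2)"
  proof -
    have "3 * R * s * q\<^sup>2 = 3 * s * (q\<^sup>2 * R ^ 3) / R\<^sup>2"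
      using pos by (simp add: field_simps power2_eq_square power3_eq_cube)
    then show ?thesis unfolding q' by simp
  qed
  then have "3 * \<mu> * P\<^sup>2 * (2 * (q / P) * \<epsilon>2 * C * B + Q * s / R\<^sup>2) = 3 * \<mu> * P\<^sup>2 * (2 * C * B * \<beta>')"
  proof -
    have "3 * \<mu> * P\<^sup>2 * (2 * (q / P) * \<epsilon>2 * C * B) = 6 * \<mu> * P * q * \<epsilon>2 * C * B"
      using pos by (simp add: power2_eq_square)
    then show ?thesis
      using balance \<open>3 * R * s * q\<^sup>2 = _\<close> by (simp add: C_def B_def distrib_left)
  qed
  then have "2 * (q / P) * \<epsilon>2 * C * B + Q * s / R\<^sup>2 = 2 * C * B * \<beta>'"
    using pos by simp
  \<comment> \<open>\<open>b\<close> is the reciprocal of the angular rate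
    \<open>h / R\<^sup>2\<close> of the position. Multiplying by it turns minus that rate into the
    term \<open>- 1\<close> of \<open>Psi\<close> and \<open>a\<close> into \<open>a * b\<close>,
    the square root.\<close>
  moreover define a b where "a = q / P" and "b = R\<^sup>2 / h"
  ultimately have "b * (2 * a * \<epsilon>2 * C * B + Q * s / R\<^sup>2) = b * (2 * C * B * (\<epsilon>1 * a - h / R\<^sup>2))"
    by (simp add: \<beta>')
  moreover have "b * (h / R\<^sup>2) = 1" "b * (Q * s / R\<^sup>2) = Q * (s / h)" "q * R\<^sup>2 / (P * h) = a * b"
    using pos by (simp_all add: a_def b_def)
  ultimately have "2 * C * B * (- 1 + \<epsilon>1 * (q * R\<^sup>2 / (P * h)) - \<epsilon>2 * (q * R\<^sup>2 / (P * h))) - Q * (s / h) = 0"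
    by algebra
  moreover have "1 + e * cos \<theta> \<noteq> 0"
    unfolding osc(1) using pos by simp
  moreover have "0 \<le> Q / (1 + e * cos \<theta>)"
    unfolding ratio by simp
  ultimately show ?thesis
    unfolding root[symmetric] tang[symmetric] by (simp add: singular_surface_def Psi_def Q_def C_def B_def)
qed

text \<open>No point of a nondegenerate interval is isolated, so derivatives within it are unique.
  This allows two derivatives of the same function to be equated.\<close>

lemma is_interval_at_within_ne_bot:
  fixes S :: "real set"
  assumes "is_interval S" "\<exists>a\<in>S. \<exists>b\<in>S. a < b" "x \<in> S"
  shows "at x within S \<noteq> bot"
proof -
  have "connected S" using assms(1) is_interval_connected by blast
  moreover have "\<nexists>a. S = {a}" using assms(2) by force
  ultimately have "x islimpt S" using assms(3) connected_imp_perfect by blast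
  then show ?thesis by (simp add: trivial_limit_within)
qed

section \<open>Regularity of the extremal and its costate on a singular arc\<close>

lemma extremal_has_vector_derivatives:
  assumes ext: "extremal \<mu> Tmax Isp g0 t0 tf x0 xf r v m c n pr pv pm" and t: "t \<in> {t0..tf}"
  shows "(r has_vector_derivative v t) (at t within {t0..tf})"
    and "(pv has_vector_derivative - pr t) (at t within {t0..tf})"
    and "(pr has_vector_derivative
       - (3 * \<mu> / norm (r t) ^ 5 * (r t \<bullet> pv t)) *\<^sub>R r t + (\<mu> / norm (r t) ^ 3) *\<^sub>R pv t)
       (at t within {t0..tf})"
proof -
  have sol: "ae_solution t0 tf r v" "ae_solution t0 tf pv (\<lambda>t. - pr t)"
    "ae_solution t0 tf pr
       (\<lambda>t. - (3 * \<mu> / norm (r t) ^ 5 * (r t \<bullet> pv t)) *\<^sub>R r t + (\<mu> / norm (r t) ^ 3) *\<^sub>R pv t)"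
    and vsol: "abs_cont_on_ivl t0 tf v"
    and r0: "\<And>t. t \<in> {t0..tf} \<Longrightarrow> r t \<noteq> 0"
    using ext unfolding extremal_def admissible_def adjoint_solution_def ae_solution_def by blast+
  \<comment> \<open>The controls do not occur in the equations for \<open>r\<close>,
    \<open>pv\<close> and \<open>pr\<close>, so their right-hand sides are continuous in time; the
    last one is because \<open>r\<close> never vanishes.\<close>
  have cont: "continuous_on {t0..tf} r" "continuous_on {t0..tf} pv" "continuous_on {t0..tf} pr"
    "continuous_on {t0..tf} v"
    using sol vsol abs_cont_on_ivl_imp_continuous_on unfolding ae_solution_def by blast+
  show "(r has_vector_derivative v t) (at t within {t0..tf})"
    by (rule ae_solution_has_vector_derivative[OF sol(1) cont(4) t])
  show "(pv has_vector_derivative - pr t) (at t within {t0..tf})"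
    by (rule ae_solution_has_vector_derivative[OF sol(2) _ t]) (intro continuous_intros cont)
  show "(pr has_vector_derivative
       - (3 * \<mu> / norm (r t) ^ 5 * (r t \<bullet> pv t)) *\<^sub>R r t + (\<mu> / norm (r t) ^ 3) *\<^sub>R pv t)
       (at t within {t0..tf})"
    by (rule ae_solution_has_vector_derivative[OF sol(3) _ t])
      (intro continuous_intros cont, use r0 in auto)
qed

text \<open>Testing maximality against the direction \<open>sgn pv\<close> forces equality in
  Cauchy-Schwarz. The scaled form covers \<open>pv = 0\<close>, where the direction is
  undetermined.\<close>

lemma optimal_direction:
  assumes "optimal_controls Tmax Isp g0 m pv pm c n" "norm n = 1"
  shows "norm pv *\<^sub>R n = pv" "pv \<bullet> n = norm pv"
proof -
  have "pv \<bullet> n = norm pv \<and> norm pv *\<^sub>R n = pv"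
  proof (cases "pv = 0")
    case False
    then have "norm (sgn pv) = 1" by (simp add: norm_sgn)
    then have "pv \<bullet> sgn pv \<le> pv \<bullet> n"
      using assms(1) unfolding optimal_controls_def by blast
    moreover have "pv \<bullet> sgn pv = norm pv"
      using False by (simp add: sgn_div_norm dot_square_norm power2_eq_square)
    moreover have "pv \<bullet> n \<le> norm pv"
      using norm_cauchy_schwarz[of pv n] assms(2) by simp
    ultimately have "pv \<bullet> n = norm pv * norm n" using assms(2) by simp
    then show ?thesis
      using norm_cauchy_schwarz_eq[of pv n] assms(2) by simp
  qed simp
  then show "norm pv *\<^sub>R n = pv" "pv \<bullet> n = norm pv" by auto
qed

lemma singular_costate:
  assumes pos: "0 < Tmax" "0 < Isp" "0 < g0"
    and ext: "extremal \<mu> Tmax Isp g0 t0 tf x0 xf r v m c n pr pv pm"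
    and S: "is_interval S" "\<exists>a\<in>S. \<exists>b\<in>S. a < b" and sub: "S \<subseteq> {t0..tf}"
    and sing: "AE t in lebesgue_on S. switching Tmax Isp g0 (m t) (pv t) (pm t) (n t) = 0"
  obtains P N where "0 < P" "\<And>t. t \<in> S \<Longrightarrow> norm (pv t) = P" "\<And>t. t \<in> S \<Longrightarrow> pv t \<bullet> pr t = 0"
    "negligible N" "\<And>t. t \<in> S - N \<Longrightarrow> P *\<^sub>R n t = pv t"
proof -
  \<comment> \<open>Solving the vanishing of the switching function for \<open>norm (pv t)\<close>
    gives \<open>w t\<close>, which is free of the direction \<open>n\<close>, and \<open>n\<close>
    need not be continuous.\<close>
  define w where "w t = pm t * m t / (Isp * g0)" for t
  have adm: "\<And>t. t \<in> {t0..tf} \<Longrightarrow> 0 < m t \<and> norm (n t) = 1"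
    and nontriv: "\<And>t. t \<in> {t0..tf} \<Longrightarrow> (pr t, pv t, pm t) \<noteq> 0"
    and msol: "ae_solution t0 tf m (\<lambda>t. - (Tmax / (Isp * g0)) * c t)"
    and pmsol: "ae_solution t0 tf pm (\<lambda>t. c t * (norm (pv t) * Tmax / (m t)\<^sup>2))"
    and ctrl: "AE t in lebesgue_on {t0..tf}.
        optimal_controls Tmax Isp g0 (m t) (pv t) (pm t) (c t) (n t)"
    using ext unfolding extremal_def admissible_def adjoint_solution_def by blast+
  have ivl: "{t0..tf} \<in> sets lebesgue" and Smeas: "S \<in> sets lebesgue"
    using real_interval_borel_measurable[OF S(1)] by auto
  obtain N1 where N1: "negligible N1" "\<And>t. t \<in> {t0..tf} - N1 \<Longrightarrow>
      optimal_controls Tmax Isp g0 (m t) (pv t) (pm t) (c t) (n t)"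
    using AE_lebesgue_on_negligible[OF ctrl ivl] by blast
  obtain N2 where N2: "negligible N2" "\<And>t. t \<in> {t0..tf} - N2 \<Longrightarrow>
      (m has_vector_derivative (- (Tmax / (Isp * g0)) * c t)) (at t within {t0..tf})"
    using AE_lebesgue_on_negligible[OF conjunct2[OF msol[unfolded ae_solution_def]] ivl] by blast
  obtain N3 where N3: "negligible N3" "\<And>t. t \<in> {t0..tf} - N3 \<Longrightarrow>
      (pm has_vector_derivative (c t * (norm (pv t) * Tmax / (m t)\<^sup>2))) (at t within {t0..tf})"
    using AE_lebesgue_on_negligible[OF conjunct2[OF pmsol[unfolded ae_solution_def]] ivl] by blast
  obtain N4 where N4: "negligible N4" "\<And>t. t \<in> S - N4 \<Longrightarrow>
      switching Tmax Isp g0 (m t) (pv t) (pm t) (n t) = 0"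
    using AE_lebesgue_on_negligible[OF sing Smeas] by blast
  define N where "N = N1 \<union> N2 \<union> N3 \<union> N4"
  have N: "negligible N" using N1 N2 N3 N4 by (simp add: N_def)
  note der = extremal_has_vector_derivatives[OF ext, THEN has_vector_derivative_within_subset, OF _ sub]
  have pv': "(pv has_vector_derivative - pr t) (at t within S)" if "t \<in> S" for t
    using der(2) that sub by blast
  have contS: "continuous_on S pv" "continuous_on S pr" "continuous_on S m" "continuous_on S pm"
    using ext abs_cont_on_ivl_imp_continuous_on continuous_on_subset[OF _ sub]
    unfolding extremal_def admissible_def adjoint_solution_def ae_solution_def by blast+
  have w_ae: "norm (pv t) = w t" if t: "t \<in> S - N" for t
  proof -
    have "pv t \<bullet> n t = norm (pv t)"
      by (rule optimal_direction(2)) (use N1(2)[of t] adm[of t] t sub in \<open>auto simp: N_def\<close>)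
    then have "norm (pv t) * (Tmax / m t) = pm t * (Tmax / (Isp * g0))"
      using N4(2)[of t] t by (simp add: switching_def N_def)
    moreover have "0 < m t" using adm t sub by blast
    ultimately show ?thesis using pos by (simp add: w_def field_simps)
  qed
  have w: "norm (pv t) = w t" if "t \<in> S" for t
    by (rule eq_on_ivl_if_eq_outside_negligible[OF S _ _ N w_ae that])
      (auto simp: w_def intro!: continuous_intros contS pos, use pos in auto)
  have perp_ae: "pv t \<bullet> pr t = 0" if t: "t \<in> S - N" for t
  proof -
    have tS: "t \<in> S" "0 < m t" using t adm sub by auto
    have m': "(m has_real_derivative (- (Tmax / (Isp * g0)) * c t)) (at t within S)"
      using N2(2)[of t] t sub has_vector_derivative_within_subset
      unfolding N_def has_real_derivative_iff_has_vector_derivative by blast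
    have pm': "(pm has_real_derivative (c t * (norm (pv t) * Tmax / (m t)\<^sup>2))) (at t within S)"
      using N3(2)[of t] t sub has_vector_derivative_within_subset
      unfolding N_def has_real_derivative_iff_has_vector_derivative by blast
    have "(w has_real_derivative
       (c t * (norm (pv t) * Tmax / (m t)\<^sup>2) * m t + pm t * (- (Tmax / (Isp * g0)) * c t)) / (Isp * g0))
       (at t within S)"
      unfolding w_def using DERIV_cdivide[OF DERIV_mult[OF pm' m']] by (simp add: algebra_simps)
    \<comment> \<open>Since \<open>norm (pv t) = w t\<close>, the change of \<open>pm\<close> and
      the loss of mass cancel whatever the throttle.\<close>
    moreover have "c t * (norm (pv t) * Tmax / (m t)\<^sup>2) * m t + pm t * (- (Tmax / (Isp * g0)) * c t) = 0"
      using w[OF tS(1)] tS(2) pos by (simp add: w_def field_simps power2_eq_square)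
    ultimately have "(w has_real_derivative 0) (at t within S)" by simp
    \<comment> \<open>Squares are compared because \<open>pv \<bullet> pv\<close> is differentiable
      even where \<open>pv\<close> vanishes, which is not excluded yet.\<close>
    then have "((\<lambda>t. w t * w t) has_real_derivative 0) (at t within S)"
      using DERIV_mult by fastforce
    then have "((\<lambda>t. pv t \<bullet> pv t) has_real_derivative 0) (at t within S)"
      by (rule has_field_derivative_transform_within[where d = 1])
        (use tS w in \<open>auto simp: dot_square_norm power2_eq_square\<close>)
    moreover have "((\<lambda>t. pv t \<bullet> pv t) has_real_derivative pv t \<bullet> (- pr t) + (- pr t) \<bullet> pv t) (at t within S)"
      using bounded_bilinear.has_vector_derivative[OF bounded_bilinear_inner pv'[OF tS(1)] pv'[OF tS(1)]]
      by (simp add: has_real_derivative_iff_has_vector_derivative)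
    ultimately have "pv t \<bullet> (- pr t) + (- pr t) \<bullet> pv t = 0"
      using vector_derivative_unique_within[OF is_interval_at_within_ne_bot[OF S tS(1)]]
      unfolding has_real_derivative_iff_has_vector_derivative by blast
    then show ?thesis by (simp add: inner_commute)
  qed
  have perp: "pv t \<bullet> pr t = 0" if "t \<in> S" for t
    by (rule eq_on_ivl_if_eq_outside_negligible[OF S _ _ N perp_ae that])
      (auto intro!: continuous_intros contS)
  have "\<exists>C. \<forall>t\<in>S. pv t \<bullet> pv t = C"
  proof (rule has_vector_derivative_zero_constant)
    show "convex S" using S(1) is_interval_convex by blast
    show "((\<lambda>t. pv t \<bullet> pv t) has_vector_derivative 0) (at t within S)" if "t \<in> S" for t
      using bounded_bilinear.has_vector_derivative[OF bounded_bilinear_inner pv'[OF that] pv'[OF that]]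
        perp[OF that] by (simp add: inner_commute)
  qed blast
  then obtain C where C: "\<And>t. t \<in> S \<Longrightarrow> pv t \<bullet> pv t = C" by blast
  define P where "P = sqrt C"
  have P: "norm (pv t) = P" if "t \<in> S" for t
    using C[OF that] by (simp add: P_def norm_eq_sqrt_inner)
  obtain s where s: "s \<in> S" using S(2) by blast
  \<comment> \<open>If \<open>P\<close> were zero, \<open>pv\<close> would vanish identically, hence
    so would \<open>pr\<close> as its negative derivative, and \<open>pm\<close> through
    \<open>w\<close>, against nontriviality.\<close>
  have "P \<noteq> 0"
  proof
    assume "P = 0"
    then have zero: "pv t = 0" if "t \<in> S" for t using P that by simp
    have "(pv has_vector_derivative 0) (at s within S)"
      using has_vector_derivative_transform[OF s zero has_vector_derivative_const] by simp
    then have "pr s = 0"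
      using vector_derivative_unique_within[OF is_interval_at_within_ne_bot[OF S s] pv'[OF s]]
      by fastforce
    moreover have "pm s = 0"
      using w[OF s] zero[OF s] adm[of s] s sub pos by (auto simp: w_def)
    ultimately show False using nontriv[of s] zero[OF s] s sub by (auto simp: zero_prod_def)
  qed
  moreover have "0 \<le> P" using P[OF s] norm_ge_zero by metis
  moreover have "P *\<^sub>R n t = pv t" if "t \<in> S - N" for t
    using optimal_direction(1)[OF N1(2)[of t]] adm[of t] P[of t] that sub by (auto simp: N_def)
  ultimately show thesis using that[of P N] P perp N by simp
qed

theorem theorem1:
  fixes \<mu> Tmax Isp g0 t0 tf :: real
    and x0 xf :: "(real^3) \<times> (real^3) \<times> real"
    and r v n pr pv :: "real \<Rightarrow> real^3"
    and m c pm :: "real \<Rightarrow> real"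
    and k d :: "real^3"
    and Is :: "real set"
    and \<alpha> \<beta> e \<theta> \<epsilon>1 \<epsilon>2 :: "real \<Rightarrow> real"
  assumes "0 < \<mu>" "0 < Tmax" "0 < Isp" "0 < g0"
    and "extremal \<mu> Tmax Isp g0 t0 tf x0 xf r v m c n pr pv pm"
    and "planar_motion k d t0 tf r v n pr pv"
    and "is_interval Is" "Is \<subseteq> {t0..tf}" "\<exists>a\<in>Is. \<exists>b\<in>Is. a < b"
    and "AE t in lebesgue_on Is. switching Tmax Isp g0 (m t) (pv t) (pm t) (n t) = 0"
    and "continuous_on Is \<alpha>" "\<forall>t\<in>Is. oriented_angle k d (r t) (\<alpha> t)"
    and "continuous_on Is \<beta>" "AE t in lebesgue_on Is. oriented_angle k (r t) (n t) (\<beta> t)"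
    and "\<forall>t\<in>Is. osculating \<mu> (r t) (v t) (e t) (\<theta> t)"
    and "\<forall>t\<in>Is. \<epsilon>1 t \<in> {1, -1} \<and>
           (let \<omega> = vector_derivative \<alpha> (at t within Is) + vector_derivative \<beta> (at t within Is)
            in \<omega> = \<epsilon>1 t * \<bar>\<omega>\<bar>)"
    and "\<forall>t\<in>Is. \<epsilon>2 t \<in> {1, -1} \<and> oriented_angle k (r t) (pr t) (\<beta> t + \<epsilon>2 t * (pi / 2))"
  shows "\<forall>t\<in>Is. (e t, \<theta> t, \<beta> t) \<in> singular_surface (\<epsilon>1 t) (\<epsilon>2 t)"
proof
  fix t assume t: "t \<in> Is"
  obtain P N where P: "0 < P" "\<And>t. t \<in> Is \<Longrightarrow> norm (pv t) = P"
    and perp: "\<And>t. t \<in> Is \<Longrightarrow> pv t \<bullet> pr t = 0"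
    and N: "negligible N" "\<And>t. t \<in> Is - N \<Longrightarrow> P *\<^sub>R n t = pv t"
    using singular_costate[OF assms(2-5,7,9,8,10)] by metis
  have adm: "r t \<noteq> 0" "norm (n t) = 1" if "t \<in> Is" for t
    using assms(5,8) that unfolding extremal_def admissible_def by blast+
  have k: "norm k = 1" "norm d = 1" "orthogonal k d"
    and plane: "\<And>t. t \<in> Is \<Longrightarrow> orthogonal k (r t)" "\<And>t. t \<in> Is \<Longrightarrow> orthogonal k (v t)"
      "\<And>t. t \<in> Is \<Longrightarrow> orthogonal k (pr t)" "\<And>t. t \<in> Is \<Longrightarrow> orthogonal k (pv t)"
      "\<And>t. t \<in> Is \<Longrightarrow> 0 < k \<bullet> (r t \<times> v t)"
    using assms(6,8) unfolding planar_motion_def by blast+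
  have d: "d \<noteq> 0" using k(2) by auto
  have nz: "at t within Is \<noteq> bot"
    by (rule is_interval_at_within_ne_bot[OF assms(7,9) t])
  have r': "(r has_vector_derivative v t) (at t within Is)"
    and pv': "(pv has_vector_derivative - pr t) (at t within Is)"
    and pr': "(pr has_vector_derivative
       - (3 * \<mu> / norm (r t) ^ 5 * (r t \<bullet> pv t)) *\<^sub>R r t + (\<mu> / norm (r t) ^ 3) *\<^sub>R pv t)
       (at t within Is)" if "t \<in> Is" for t
    using extremal_has_vector_derivatives[OF assms(5), THEN has_vector_derivative_within_subset, OF _ assms(8)]
      that assms(8) by blast+
  have cont: "continuous_on Is r" "continuous_on Is pv"
    using r' pv' has_vector_derivative_continuous unfolding continuous_on_eq_continuous_within by blast+

  have "Is \<in> sets lebesgue" using real_interval_borel_measurable[OF assms(7)] by simp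
  then obtain N' where N': "negligible N'" "\<And>t. t \<in> Is - N' \<Longrightarrow> oriented_angle k (r t) (n t) (\<beta> t)"
    using AE_lebesgue_on_negligible[OF assms(14)] by blast
  \<comment> \<open>The angle \<beta> is prescribed only almost everywhere and for \<open>n\<close>;
    scaled by \<open>P\<close>, the relation passes to \<open>pv\<close> and by continuity to every
    time.\<close>
  have pv_angle: "oriented_angle k (r t) (pv t) (\<beta> t)" if "t \<in> Is" for t
  proof -
    have "norm (r t) *\<^sub>R pv t = P *\<^sub>R (cos (\<beta> t) *\<^sub>R r t + sin (\<beta> t) *\<^sub>R (k \<times> r t))"
    proof (rule eq_on_ivl_if_eq_outside_negligible[OF assms(7,9) _ _ _ _ that])
      show "negligible (N \<union> N')" using N(1) N'(1) by simp
      show "norm (r t) *\<^sub>R pv t = P *\<^sub>R (cos (\<beta> t) *\<^sub>R r t + sin (\<beta> t) *\<^sub>R (k \<times> r t))"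
        if "t \<in> Is - (N \<union> N')" for t
      proof -
        have "norm (r t) *\<^sub>R n t = cos (\<beta> t) *\<^sub>R r t + sin (\<beta> t) *\<^sub>R (k \<times> r t)"
          using N'(2)[of t] adm(2)[of t] that by (simp add: oriented_angle_def)
        moreover have "norm (r t) *\<^sub>R pv t = P *\<^sub>R (norm (r t) *\<^sub>R n t)"
          using N(2)[of t] that by (metis DiffD1 DiffD2 DiffI UnI1 scaleR_left_commute)
        ultimately show ?thesis by simp
      qed
    qed (intro continuous_intros continuous_on_cross cont assms(13))+
    then show ?thesis using P(2)[OF that] by (simp add: oriented_angle_def)
  qed
  have r_pv: "r t \<bullet> pv t = norm (r t) * P * cos (\<beta> t)" if "t \<in> Is" for t
    using oriented_angle_inner[OF pv_angle[OF that]] P(2)[OF that] by simp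
  have pr_angle: "oriented_angle k (r t) (pr t) (\<beta> t + \<epsilon>2 t * (pi / 2))"
    and eps2: "\<epsilon>2 t \<in> {1, -1}" and eps1: "\<epsilon>1 t \<in> {1, -1}"
    using assms(16,17) t by blast+

  \<comment> \<open>Proved on the whole of \<open>Is\<close> rather than at the fixed time, since it
    is differentiated in \<open>balance\<close>.\<close>
  have speed: "(norm (pr t))\<^sup>2 * norm (r t) ^ 3 = \<mu> * P\<^sup>2 * (1 - 3 * (cos (\<beta> t))\<^sup>2)" if "t \<in> Is" for t
  proof -
    let ?a = "- (3 * \<mu> / norm (r t) ^ 5 * (r t \<bullet> pv t)) *\<^sub>R r t + (\<mu> / norm (r t) ^ 3) *\<^sub>R pv t"
    have "((\<lambda>t. pv t \<bullet> pr t) has_vector_derivative pv t \<bullet> ?a + (- pr t) \<bullet> pr t) (at t within Is)"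
      by (rule bounded_bilinear.has_vector_derivative[OF bounded_bilinear_inner pv'[OF that] pr'[OF that]])
    moreover have "((\<lambda>t. pv t \<bullet> pr t) has_vector_derivative 0) (at t within Is)"
      by (rule has_vector_derivative_transform[OF that perp has_vector_derivative_const])
    ultimately have "pv t \<bullet> ?a + (- pr t) \<bullet> pr t = 0"
      using vector_derivative_unique_within[OF is_interval_at_within_ne_bot[OF assms(7,9) that]] by blast
    then have "(norm (pr t))\<^sup>2 = pv t \<bullet> ?a" by (simp add: dot_square_norm)
    also have "\<dots> = - (3 * \<mu> / norm (r t) ^ 5 * (r t \<bullet> pv t)) * (r t \<bullet> pv t) + (\<mu> / norm (r t) ^ 3) * P\<^sup>2"
      using P(2)[OF that] by (simp add: inner_add_right inner_diff_right dot_square_norm inner_commute)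
    finally show ?thesis
      using adm(1)[OF that] unfolding r_pv[OF that]
      by (simp add: field_simps eval_nat_numeral)
  qed

  define R where "R = norm (r t)"
  define q where "q = norm (pr t)"
  define h where "h = norm (r t \<times> v t)"
  have R: "0 < R" using adm(1)[OF t] by (simp add: R_def)
  \<comment> \<open>The normal \<open>k\<close> lies on the side of the angular momentum, so the
    signed component is the positive norm \<open>h\<close>.\<close>
  have h: "k \<bullet> (r t \<times> v t) = h"
  proof -
    have "h = norm ((k \<bullet> (r t \<times> v t)) *\<^sub>R k)"
      unfolding h_def by (metis cross_eq_scaled_normal[OF k(1) plane(1,2)] t)
    then show ?thesis using plane(5)[OF t] k(1) by simp
  qed
  have "0 < h" using plane(5)[OF t] h by simp

  have "(\<alpha> has_vector_derivative ((k \<times> r t) \<bullet> v t) / (norm (r t))\<^sup>2) (at t within Is)"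
    by (rule oriented_angle_has_vector_derivative[OF k(1,3) d t plane(1) assms(11) _ r'[OF t] adm(1)[OF t]])
      (use assms(12) in auto)
  then have \<alpha>': "(\<alpha> has_vector_derivative h / R\<^sup>2) (at t within Is)"
    using h by (simp add: triple_product_cyclic R_def)
  \<comment> \<open>Adding angles, \<alpha> + \<beta> is the angle from \<open>d\<close> to
    \<open>pv\<close>, and the derivative of \<open>pv\<close> is \<open>- pr\<close>.\<close>
  have "((\<lambda>t. \<alpha> t + \<beta> t) has_vector_derivative ((k \<times> pv t) \<bullet> (- pr t)) / (norm (pv t))\<^sup>2) (at t within Is)"
  proof (rule oriented_angle_has_vector_derivative[OF k(1,3) d t plane(4) _ _ pv'[OF t]])
    show "continuous_on Is (\<lambda>t. \<alpha> t + \<beta> t)"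
      by (intro continuous_intros assms(11,13))
    show "oriented_angle k d (pv t) (\<alpha> t + \<beta> t)" if "t \<in> Is" for t
      by (rule oriented_angle_add[OF k(1,3) adm(1)[OF that] _ pv_angle[OF that]]) (use assms(12) that in blast)
    show "pv t \<noteq> 0" using P t by force
  qed
  moreover have "(k \<times> pv t) \<bullet> pr t = P * q * \<epsilon>2 t"
  proof -
    have "(k \<times> pv t) \<bullet> pr t = P * q * sin (\<epsilon>2 t * (pi / 2))"
      using oriented_angle_cross_inner_diff[OF k(1) plane(1)[OF t] plane(4)[OF t] plane(3)[OF t]
          adm(1)[OF t] pv_angle[OF t] pr_angle] P(2)[OF t] by (simp add: q_def)
    then show ?thesis using eps2 by auto
  qed
  ultimately have \<delta>': "((\<lambda>t. \<alpha> t + \<beta> t) has_vector_derivative - \<epsilon>2 t * q / P) (at t within Is)"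
    using P(1) P(2)[OF t] by (simp add: power2_eq_square mult.commute)
  \<comment> \<open>\<beta> is assumed only continuous; its differentiability comes from subtracting
    \<alpha> from \<alpha> + \<beta>.\<close>
  define \<beta>' where "\<beta>' = - \<epsilon>2 t * q / P - h / R\<^sup>2"
  have \<beta>: "(\<beta> has_vector_derivative \<beta>') (at t within Is)"
    using has_vector_derivative_diff[OF \<delta>' \<alpha>'] by (simp add: \<beta>'_def)
  have \<omega>: "h / R\<^sup>2 + \<beta>' = \<epsilon>1 t * \<bar>h / R\<^sup>2 + \<beta>'\<bar>"
    using bspec[OF assms(16) t]
    unfolding Let_def vector_derivative_within[OF nz \<alpha>'] vector_derivative_within[OF nz \<beta>] by blast

  \<comment> \<open>Both sides of \<open>speed\<close> are differentiated, the left one through the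
    costate equation and the derivative of the distance, the right one through the chain rule in
    \<beta>.\<close>
  have balance: "6 * \<mu> * P * q * \<epsilon>2 t * cos (\<beta> t) * sin (\<beta> t) + 3 * R * (r t \<bullet> v t) * q\<^sup>2
      = 6 * \<mu> * P\<^sup>2 * cos (\<beta> t) * sin (\<beta> t) * \<beta>'"
  proof -
    let ?a = "- (3 * \<mu> / norm (r t) ^ 5 * (r t \<bullet> pv t)) *\<^sub>R r t + (\<mu> / norm (r t) ^ 3) *\<^sub>R pv t"
    have r_pr: "r t \<bullet> pr t = - (\<epsilon>2 t * R * q * sin (\<beta> t))"
      using oriented_angle_inner[OF pr_angle] eps2 by (auto simp: R_def q_def cos_add)
    have "((\<lambda>t. pr t \<bullet> pr t) has_real_derivative pr t \<bullet> ?a + ?a \<bullet> pr t) (at t within Is)"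
      unfolding has_real_derivative_iff_has_vector_derivative
      by (rule bounded_bilinear.has_vector_derivative[OF bounded_bilinear_inner pr'[OF t] pr'[OF t]])
    \<comment> \<open>Only the radial part of \<open>?a\<close> contributes, because
      \<open>pv\<close> and \<open>pr\<close> are orthogonal.\<close>
    moreover have "pr t \<bullet> ?a + ?a \<bullet> pr t = 6 * \<mu> / R ^ 3 * P * q * \<epsilon>2 t * cos (\<beta> t) * sin (\<beta> t)"
    proof -
      have "pr t \<bullet> ?a + ?a \<bullet> pr t
          = - 2 * (3 * \<mu> / R ^ 5 * (r t \<bullet> pv t)) * (r t \<bullet> pr t) + 2 * (\<mu> / R ^ 3) * (pv t \<bullet> pr t)"
        by (simp add: inner_add_right inner_add_left inner_diff_right inner_diff_left inner_commute R_def
            algebra_simps)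
      then show ?thesis
        using R unfolding r_pr r_pv[OF t] perp[OF t] R_def[symmetric]
        by (simp add: field_simps eval_nat_numeral)
    qed
    ultimately have q': "((\<lambda>t. pr t \<bullet> pr t) has_real_derivative
        6 * \<mu> / R ^ 3 * P * q * \<epsilon>2 t * cos (\<beta> t) * sin (\<beta> t)) (at t within Is)" by simp
    have "((\<lambda>t. sqrt (r t \<bullet> r t)) has_real_derivative (r t \<bullet> v t) / R) (at t within Is)"
    proof -
      have "((\<lambda>t. r t \<bullet> r t) has_real_derivative r t \<bullet> v t + v t \<bullet> r t) (at t within Is)"
        unfolding has_real_derivative_iff_has_vector_derivative
        by (rule bounded_bilinear.has_vector_derivative[OF bounded_bilinear_inner r'[OF t] r'[OF t]])
      moreover have "(sqrt has_real_derivative inverse R / 2) (at (r t \<bullet> r t))"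
        using DERIV_real_sqrt[of "r t \<bullet> r t"] adm(1)[OF t] by (simp add: R_def norm_eq_sqrt_inner)
      ultimately have "((\<lambda>t. sqrt (r t \<bullet> r t)) has_real_derivative
          inverse R / 2 * (r t \<bullet> v t + v t \<bullet> r t)) (at t within Is)"
        by (rule DERIV_chain2[rotated])
      then show ?thesis by (simp add: inner_commute field_simps)
    qed
    then have R': "((\<lambda>t. norm (r t)) has_real_derivative (r t \<bullet> v t) / R) (at t within Is)"
      by (simp add: norm_eq_sqrt_inner)
    have "((\<lambda>t. (pr t \<bullet> pr t) * norm (r t) ^ 3) has_real_derivative
        6 * \<mu> / R ^ 3 * P * q * \<epsilon>2 t * cos (\<beta> t) * sin (\<beta> t) * R ^ 3
        + 3 * R\<^sup>2 * ((r t \<bullet> v t) / R) * q\<^sup>2) (at t within Is)"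
      by (rule derivative_eq_intros q' R' refl)+ (simp add: R_def q_def dot_square_norm)
    then have lhs: "((\<lambda>t. (pr t \<bullet> pr t) * norm (r t) ^ 3) has_real_derivative
        6 * \<mu> * P * q * \<epsilon>2 t * cos (\<beta> t) * sin (\<beta> t) + 3 * R * (r t \<bullet> v t) * q\<^sup>2) (at t within Is)"
      using R by (simp add: power2_eq_square mult.assoc)
    have "((\<lambda>t. \<mu> * P\<^sup>2 * (1 - 3 * (cos (\<beta> t))\<^sup>2)) has_real_derivative
        6 * \<mu> * P\<^sup>2 * cos (\<beta> t) * sin (\<beta> t) * \<beta>') (at t within Is)"
      by (rule derivative_eq_intros \<beta>[folded has_real_derivative_iff_has_vector_derivative] refl)+ simp
    then have "((\<lambda>t. (pr t \<bullet> pr t) * norm (r t) ^ 3) has_real_derivative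
        6 * \<mu> * P\<^sup>2 * cos (\<beta> t) * sin (\<beta> t) * \<beta>') (at t within Is)"
      by (rule has_field_derivative_transform_within[where d = 1])
        (use t speed in \<open>auto simp: dot_square_norm\<close>)
    then show ?thesis
      using lhs vector_derivative_unique_within[OF nz]
      unfolding has_real_derivative_iff_has_vector_derivative by blast
  qed

  have osc: "1 + e t * cos (\<theta> t) = h\<^sup>2 / (\<mu> * R)" "\<mu> * e t * sin (\<theta> t) / h = (r t \<bullet> v t) / R"
    using assms(15) t by (auto simp: osculating_def h_def R_def)
  show "(e t, \<theta> t, \<beta> t) \<in> singular_surface (\<epsilon>1 t) (\<epsilon>2 t)"
    by (rule singular_surface_if_balance[OF assms(1) R P(1) _ \<open>0 < h\<close> eps1 eps2
          speed[OF t, folded R_def q_def] balance _ \<omega> osc]) (simp_all add: q_def \<beta>'_def)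
qed

end
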